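(* Let $n$ be a positive integer and let $\delta$ satisfy $10^4\frac{\log_2 n}{n}\leq\delta\leq\frac12$. Let $\mathcal{A},\mathcal{B}\subseteq 2^{[n]}$ be set families with $|\mathcal{A}|=|\mathcal{B}|=m=2^{(1/2+\delta)n}$. Then $$d(\mathcal{A},\mathcal{B})\leq 2^{-\frac{\delta}{100\log_2(1/\delta)}n}.$$
   Context: For families $\mathcal{A},\mathcal{B}\subseteq 2^{[n]}$, $d(\mathcal{A},\mathcal{B})$ is the number of pairs $(A,B)\in\mathcal{A}\times\mathcal{B}$ with $A\cap B=\varnothing$ divided by $|\mathcal{A}||\mathcal{B}|$. Logarithms are base 2. *)

theory Defs
  imports Complex_Main
begin

definition disjointness_density :: "'a set set \<Rightarrow> 'a set set \<Rightarrow> real" where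
  "disjointness_density \<A> \<B> =
     real (card {(A, B) \<in> \<A> \<times> \<B>. A \<inter> B = {}}) / (real (card \<A>) * real (card \<B>))"

end

theory Submission
  imports Defs "HOL-Analysis.Convex" "HOL-Analysis.Harmonic_Numbers"
begin

text \<open>
  With \<open>q = 100 log\<^sub>2 (1/\<delta>)\<close> and \<open>s = 1 - 1/q\<close>, the number of disjoint pairs in \<open>\<A> \<times> \<B>\<close> is at most
  \<open>(2 + \<delta>)\<^bsup>n/q\<^esup> \<bar>\<A>\<bar>\<^sup>s \<bar>\<B>\<bar>\<^sup>s\<close>. A bound of this form tensorises: splitting both families according to
  whether they contain a given point reduces it, by induction on the ground set, to a two-point
  inequality for nonnegative reals. Hoelder's inequality in one of the two variables turns that
  into a one-variable estimate. Since \<open>2 + \<delta> \<le> 2\<^bsup>1+\<delta>\<^esup>\<close> and \<open>m\<^sup>2 = 2\<^bsup>(1+2\<delta>)n\<^esup>\<close>, the density is then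
  at most \<open>2\<^bsup>-\<delta>n/q\<^esup>\<close>.
\<close>

section \<open>One-variable real inequalities\<close>

lemma weighted_am_gm:
  fixes u v \<eta> :: real
  assumes "0 \<le> u" "0 \<le> v" "0 < \<eta>" "\<eta> < 1"
  shows "u powr (1 - \<eta>) * v powr \<eta> \<le> (1 - \<eta>) * u + \<eta> * v"
proof (cases "u = 0 \<or> v = 0")
  case True
  then show ?thesis using assms by auto
next
  case False
  then show ?thesis using Youngs_inequality_0[of "1 - \<eta>" \<eta> u v] assms by simp
qed

lemma one_minus_powr_le_exp:
  fixes t r :: real
  assumes "0 \<le> t" "t \<le> 1" "0 \<le> r"
  shows "(1 - t) powr r \<le> exp (- (r * t))"
proof (cases "t = 1")
  case False
  then have "ln (1 - t) \<le> - t" using ln_le_minus_one[of "1 - t"] assms by simp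
  then have "r * ln (1 - t) \<le> - (r * t)"
    using mult_left_mono[of "ln (1 - t)" "- t" r] assms by simp
  then show ?thesis using False by (simp add: powr_def)
qed simp

text \<open>Weighted AM-GM of each summand against 1/2. Both sides agree at \<open>t = 1/2\<close>,
  so nothing is lost there.\<close>

lemma powr_add_powr_le_two:
  fixes t \<eta> :: real
  assumes "0 \<le> t" "t \<le> 1" "0 < \<eta>" "\<eta> < 1"
  shows "(1 - t) powr (1 - \<eta>) + t powr (1 - \<eta>) \<le> 2 powr \<eta>"
proof -
  have "(1 - t) powr (1 - \<eta>) * (1/2) powr \<eta> + t powr (1 - \<eta>) * (1/2) powr \<eta>
      \<le> ((1 - \<eta>) * (1 - t) + \<eta> * (1/2)) + ((1 - \<eta>) * t + \<eta> * (1/2))"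
    using assms by (intro add_mono weighted_am_gm) auto
  also have "\<dots> = 1" by (simp add: field_simps)
  finally show ?thesis by (simp add: powr_divide field_simps)
qed

text \<open>
  If \<open>t\<close> is not small, the first term is at most 2 and the second at most \<open>\<delta>\<close>. If \<open>t\<close> is small,
  the first term exceeds 1 by about \<open>t ln (1/t)\<close>, which the decrease \<open>q t\<close> of the second term
  compensates unless \<open>ln (1/t)\<close> is larger than \<open>q\<close>; in that range \<open>t\<close> is negligible against \<open>\<delta>\<close>.
\<close>
lemma powr_sum_bound:
  fixes t \<delta> q :: real
  assumes d: "0 < \<delta>" "\<delta> \<le> 1/2" and q: "q = 100 * log 2 (1 / \<delta>)" and t: "0 \<le> t" "t \<le> 1"
  shows "((1 - t) powr (1 - 1/q) + t powr (1 - 1/q)) powr q + (1 - t) powr (q - 1) \<le> 2 + \<delta>"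
proof -
  define L where "L = - ln \<delta>"
  define s where "s = 1 - 1/q"
  define P where "P = (1 - t) powr s + t powr s"
  have qL: "q * ln 2 = 100 * L"
    using d by (simp add: q L_def log_def ln_div)
  have "ln \<delta> \<le> ln (1/2)" using d by (subst ln_le_cancel_iff) auto
  then have L2: "ln 2 \<le> L" by (simp add: L_def ln_div)
  have Lpos: "L > 0" using L2 ln_gt_zero[of "2::real"] by linarith
  have q100: "100 \<le> q"
  proof -
    have "100 * ln 2 \<le> q * ln 2" using qL L2 by simp
    then show ?thesis by simp
  qed
  \<comment> \<open>Here q = 100 L / ln 2, and 2/3 <= ln 2 <= 25/36 gives 144 L <= q <= 150
    L.\<close>
  have q144: "144 * L \<le> q"
  proof -
    have "q * ln 2 \<le> q * (25/36)" using ln2_le_25_over_36 q100 by (intro mult_left_mono) auto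
    then show ?thesis using qL by simp
  qed
  have q150: "q \<le> 150 * L"
  proof -
    have "q * (2/3) \<le> q * ln 2" using ln2_ge_two_thirds q100 by (intro mult_left_mono) auto
    then show ?thesis using qL by simp
  qed
  have P0: "0 \<le> P" by (simp add: P_def)
  have eta: "0 < 1/q" "1/q \<le> 1/100" using q100 by (auto simp: field_simps)
  have Q: "(1 - t) powr (q - 1) \<le> exp (- ((q - 1) * t))"
    using one_minus_powr_le_exp t q100 by simp
  have "P powr q + (1 - t) powr (q - 1) \<le> 2 + \<delta>"
  \<comment> \<open>Since q >= 100, q - 1 >= 0.99 q >= 140 L; hence from t = 1/140 on the second
    term is at most exp(-L) = \<delta>.\<close>
  proof (cases "t \<ge> 1/140")
    case True
    have "P powr q \<le> (2 powr (1/q)) powr q"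
      unfolding P_def s_def using powr_add_powr_le_two[of t "1/q"] t eta q100
      by (intro powr_mono2) auto
    then have "P powr q \<le> 2" using q100 by (simp add: powr_powr)
    moreover have "L \<le> (q - 1) * (1/140)" using q100 q144 by simp
    then have "L \<le> (q - 1) * t"
      by (rule order_trans) (use True q100 in \<open>intro mult_left_mono; simp\<close>)
    then have "exp (- ((q - 1) * t)) \<le> exp (- L)" by simp
    then have "exp (- ((q - 1) * t)) \<le> \<delta>" using d by (simp add: L_def)
    ultimately show ?thesis using Q by linarith
  next
    case small: False
    show ?thesis
    proof (cases "t = 0")
      case True
      then show ?thesis using d by (simp add: P_def)
    next
      case False
      then have t0: "0 < t" using t by simp
      \<comment> \<open>AM-GM against 1 is Bernoulli's inequality (1 - t)^s <= 1 - s t. Together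
        with 1 + x <= exp x it turns the q-th power into a factor q in the exponent, leaving only
        t^s - t to estimate.\<close>
      have "(1 - t) powr s * 1 powr (1/q) \<le> s * (1 - t) + (1/q) * 1"
        unfolding s_def using t eta q100 by (intro weighted_am_gm) auto
      then have "P \<le> 1 + (t / q - t + t powr s)"
        by (simp add: P_def s_def algebra_simps diff_divide_distrib)
      also have "\<dots> \<le> exp (t / q - t + t powr s)" by (rule exp_ge_add_one_self)
      finally have "P powr q \<le> exp (t / q - t + t powr s) powr q"
        using P0 q100 by (intro powr_mono2) auto
      also have "\<dots> = exp (t + q * (t powr s - t))"
        using q100 by (simp add: powr_def algebra_simps)
      finally have P: "P powr q \<le> exp (t + q * (t powr s - t))" .
      show ?thesis
      \<comment> \<open>The exponent 16 serves both ranges. Below, 16 s >= 15 makes q t^s at most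
        150 \<delta>^14, hence at most \<delta>/2. Above, ln (1/t) < 16 L <= q/9, because 144 = 9 *
        16.\<close>
      proof (cases "t \<le> \<delta> ^ 16")
        case True
        have "t powr s \<le> (\<delta> ^ 16) powr s"
          using True t eta by (intro powr_mono2) (auto simp: s_def)
        also have "\<dots> = \<delta> powr (16 * s)" using d by (simp add: powr_powr flip: powr_numeral)
        also have "\<dots> \<le> \<delta> powr 15" using d eta by (intro powr_mono') (auto simp: s_def)
        also have "\<dots> = \<delta> ^ 15" using d by (simp add: powr_numeral)
        finally have ts: "t powr s \<le> \<delta> ^ 15" .
        have "L \<le> 1 / \<delta>" using ln_le_minus_one[of "1 / \<delta>"] d by (simp add: L_def ln_div)
        then have "q \<le> 150 / \<delta>" using q150 by simp
        then have "q * t powr s \<le> (150 / \<delta>) * \<delta> ^ 15"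
          using ts d by (intro mult_mono) auto
        also have "\<dots> = 150 * \<delta> ^ 13 * \<delta>" using d by (simp add: field_simps eval_nat_numeral)
        also have "\<dots> \<le> 150 * (1/2) ^ 13 * \<delta>"
          using d by (intro mult_right_mono mult_left_mono power_mono) auto
        also have "\<dots> \<le> \<delta> / 2" using d by (simp add: power_one_over)
        finally have "q * t powr s \<le> \<delta> / 2" .
        moreover have "t \<le> q * t" using t0 q100 by simp
        ultimately have "P powr q \<le> exp (\<delta> / 2)"
          using P by (elim order_trans) (simp add: algebra_simps)
        also have "\<dots> \<le> 1 + \<delta> / 2 + (\<delta> / 2)\<^sup>2" using d by (intro exp_bound) auto
        also have "(\<delta> / 2)\<^sup>2 \<le> \<delta> / 2"
          unfolding power2_eq_square using d by (intro mult_left_le) auto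
        finally have "P powr q \<le> 1 + \<delta>" by simp
        moreover have "(1 - t) powr (q - 1) \<le> 1"
          using t q100 by (intro powr_le1) auto
        ultimately show ?thesis by linarith
      next
        case False
        \<comment> \<open>Now t^s = t exp(l/q), and exp x <= 1 + 2 x on [0,1] gives q (t^s - t) <= 2
          t l; so \<open>u\<close> bounds the exponent.\<close>
        define l where "l = - ln t"
        define u where "u = t + 2 * t * l"
        have "ln (\<delta> ^ 16) \<le> ln t" using False d t0 by (subst ln_le_cancel_iff) auto
        then have l9: "l \<le> q / 9" using q144 d by (simp add: l_def L_def ln_realpow)
        have l0: "0 \<le> l" using t0 t by (simp add: l_def)
        have lq: "0 \<le> l / q" "l / q \<le> 1" using l9 l0 q100 by (auto simp: field_simps)
        have "exp (l / q) \<le> 1 + l / q + (l / q)\<^sup>2" using lq by (rule exp_bound)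
        also have "(l / q)\<^sup>2 \<le> l / q"
          unfolding power2_eq_square using lq by (intro mult_left_le)
        finally have "t * exp (l / q) \<le> t * (1 + 2 * (l / q))"
          using t0 by (intro mult_left_mono) auto
        moreover have "t powr s = t * exp (l / q)"
          using t0 by (simp add: powr_def s_def l_def algebra_simps exp_diff exp_minus field_simps)
        ultimately have "q * (t powr s - t) \<le> q * (t * (2 * (l / q)))"
          using q100 by (intro mult_left_mono) (auto simp: algebra_simps)
        also have "\<dots> = 2 * t * l" using q100 by simp
        finally have Pu: "P powr q \<le> exp u" using P by (elim order_trans) (simp add: u_def)
        have u0: "0 \<le> u" using t0 l0 by (simp add: u_def)
        \<comment> \<open>The square root makes t l small: l = 2 ln (1/r) <= 2/r yields t l <= 2 r,
          whereas ln (1/t) <= 1/t would only give t l <= 1.\<close>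
        define r where "r = sqrt t"
        have r: "r > 0" "t = r * r" using t0 by (auto simp: r_def)
        have r85: "r \<le> 85/1000"
        proof (rule ccontr)
          assume "\<not> ?thesis"
          then have "(85/1000) * (85/1000) \<le> r * r" by (intro mult_mono) auto
          then show False using small r by simp
        qed
        have "ln (1 / r) \<le> 1 / r" using ln_le_minus_one[of "1 / r"] r by simp
        then have "l \<le> 2 / r" using r by (simp add: l_def ln_mult ln_div)
        then have "t * l \<le> t * (2 / r)" using t0 by (intro mult_left_mono) auto
        then have "t * l \<le> 2 * r" using r by simp
        then have u: "u \<le> 348/1000" using r85 small by (simp add: u_def)
        have "exp u \<le> 1 + u + u\<^sup>2" using u0 u by (intro exp_bound) auto
        moreover have "u\<^sup>2 \<le> (348/1000) * u"
          unfolding power2_eq_square using u0 u by (intro mult_right_mono)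
        ultimately have eu: "exp u \<le> 1 + (1348/1000) * u" by simp
        define w where "w = (q - 1) * t"
        have w0: "0 \<le> w" using t0 q100 by (simp add: w_def)
        have "exp (- w) \<le> 1 / (1 + w)"
          using exp_ge_add_one_self[of w] w0 by (simp add: exp_minus field_simps)
        then have Qw: "(1 - t) powr (q - 1) \<le> 1 / (1 + w)" using Q by (simp add: w_def)
        show ?thesis
        \<comment> \<open>For w >= 1 the sum is at most 1 + 1.348 * 0.348 + 1/2 < 2. For w < 1 the
          second term has dropped by at least w/2 >= 2 u, more than the gain 1.348 u of the
          first.\<close>
        proof (cases "w \<ge> 1")
          case True
          then have "1 / (1 + w) \<le> 1/2" by (simp add: field_simps)
          then show ?thesis using Qw Pu eu u d by simp
        next
          case False
          then have "w * w \<le> w" using w0 by (simp add: mult_left_le)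
          then have "1 / (1 + w) \<le> 1 - w / 2" using w0 by (simp add: field_simps)
          moreover have "2 * u \<le> w / 2"
          proof -
            have "t * (2 + 4 * l) \<le> t * ((q - 1) / 2)"
              using l9 q100 t0 by (intro mult_left_mono) auto
            then show ?thesis by (simp add: u_def w_def algebra_simps)
          qed
          ultimately show ?thesis using Qw Pu eu u0 d by simp
        qed
      qed
    qed
  qed
  then show ?thesis by (simp add: P_def s_def)
qed

section \<open>Two-point inequality and induction on the ground set\<close>

text \<open>After scaling both sums to 1, the left side is (1 - u)^s P + u^s Q with P = (1 - t)^s +
  t^s and Q = (1 - t)^s. Hoelder in u with exponents 1/s and q bounds it by (P^q + Q^q)^(1/q), and
  Q^q = (1 - t)^(q - 1) makes this the one-variable hypothesis.\<close>

lemma two_point_inequality: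
  fixes a0 a1 b0 b1 C q :: real
  assumes q: "1 < q"
    and bound: "\<And>t. 0 \<le> t \<Longrightarrow> t \<le> 1 \<Longrightarrow>
      ((1 - t) powr (1 - 1/q) + t powr (1 - 1/q)) powr q + (1 - t) powr (q - 1) \<le> C"
    and nonneg: "0 \<le> a0" "0 \<le> a1" "0 \<le> b0" "0 \<le> b1"
  defines "s \<equiv> 1 - 1/q"
  shows "a0 powr s * b0 powr s + a0 powr s * b1 powr s + a1 powr s * b0 powr s
    \<le> C powr (1/q) * ((a0 + a1) powr s * (b0 + b1) powr s)"
proof (cases "a0 + a1 = 0 \<or> b0 + b1 = 0")
  case True
  then show ?thesis using nonneg by (auto simp: add_nonneg_eq_0_iff)
next
  case False
  define a b where "a = a0 + a1" and "b = b0 + b1"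
  have ab: "a > 0" "b > 0" using False nonneg by (auto simp: a_def b_def)
  define u t where "u = a1 / a" and "t = b1 / b"
  have ut: "0 \<le> u" "u \<le> 1" "0 \<le> t" "t \<le> 1"
    using ab nonneg by (auto simp: u_def t_def a_def b_def)
  have eq: "a0 = (1 - u) * a" "a1 = u * a" "b0 = (1 - t) * b" "b1 = t * b"
    using ab by (auto simp: u_def t_def a_def b_def field_simps)
  define P Q where "P = (1 - t) powr s + t powr s" and "Q = (1 - t) powr s"
  define N where "N = P powr q + Q powr q"
  have eta: "0 < 1/q" "1/q < 1" using q by auto
  have PQ: "0 \<le> P" "0 \<le> Q" by (auto simp: P_def Q_def)
  have "P > 0"
    using ut by (cases "t = 0") (auto simp: P_def intro!: add_nonneg_pos)
  then have N0: "0 < N" by (simp add: N_def add_pos_nonneg)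
  have "Q powr q = (1 - t) powr (q - 1)"
    using q by (simp add: Q_def powr_powr s_def algebra_simps)
  then have NC: "N \<le> C" using bound[of t] ut by (simp add: N_def P_def s_def)
  \<comment> \<open>Hoelder's inequality by termwise AM-GM: dividing by \<open>N\<close> makes the
    weights P^q/N and Q^q/N sum to 1.\<close>
  have "(1 - u) powr s * (P powr q / N) powr (1/q) + u powr s * (Q powr q / N) powr (1/q)
    \<le> ((1 - 1/q) * (1 - u) + (1/q) * (P powr q / N)) + ((1 - 1/q) * u + (1/q) * (Q powr q / N))"
    unfolding s_def using ut eta N0 by (intro add_mono weighted_am_gm) auto
  also have "\<dots> = (1 - 1/q) + (1/q) * ((P powr q + Q powr q) / N)"
    by (simp add: algebra_simps add_divide_distrib diff_divide_distrib)
  also have "\<dots> = 1" using N0 by (simp add: N_def)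
  also have "(P powr q / N) powr (1/q) = P / N powr (1/q)"
    using q PQ N0 by (simp add: powr_divide powr_powr)
  also have "(Q powr q / N) powr (1/q) = Q / N powr (1/q)"
    using q PQ N0 by (simp add: powr_divide powr_powr)
  finally have "(1 - u) powr s * P + u powr s * Q \<le> N powr (1/q)"
    using N0 by (simp add: field_simps)
  also have "\<dots> \<le> C powr (1/q)" using NC N0 eta by (intro powr_mono2) auto
  finally have *: "((1 - u) powr s * P + u powr s * Q) * (a powr s * b powr s)
      \<le> C powr (1/q) * (a powr s * b powr s)"
    by (intro mult_right_mono) auto
  have "a0 powr s * b0 powr s + a0 powr s * b1 powr s + a1 powr s * b0 powr s
      = ((1 - u) powr s * P + u powr s * Q) * (a powr s * b powr s)"
    unfolding eq powr_mult P_def Q_def by (simp only: distrib_left distrib_right mult_ac add_ac)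
  then show ?thesis using * by (simp add: a_def b_def)
qed

text \<open>Split each family by membership of a point x and delete x. Disjoint sets do not both
  contain x, so three of the four combinations remain, matching the three terms of
  \<open>two_point\<close>; each point costs one factor \<open>C\<close>.\<close>

lemma card_disjoint_pairs_le:
  fixes S :: "'a set" and \<A> \<B> :: "'a set set" and C s :: real
  assumes two_point: "\<And>a0 a1 b0 b1. 0 \<le> a0 \<Longrightarrow> 0 \<le> a1 \<Longrightarrow> 0 \<le> b0 \<Longrightarrow> 0 \<le> b1 \<Longrightarrow>
      a0 powr s * b0 powr s + a0 powr s * b1 powr s + a1 powr s * b0 powr s
        \<le> C * ((a0 + a1) powr s * (b0 + b1) powr s)"
    and C: "0 \<le> C"
    and "finite S" "\<A> \<subseteq> Pow S" "\<B> \<subseteq> Pow S"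
  shows "real (card {(A, B) \<in> \<A> \<times> \<B>. A \<inter> B = {}})
    \<le> C ^ card S * (real (card \<A>) powr s * real (card \<B>) powr s)"
  using assms(3-5)
proof (induction S arbitrary: \<A> \<B> rule: finite_induct)
  case empty
  then have sub: "\<A> \<subseteq> {{}}" "\<B> \<subseteq> {{}}" by auto
  show ?case
  proof (cases "\<A> = {{}} \<and> \<B> = {{}}")
    case True
    then have "{(A, B) \<in> \<A> \<times> \<B>. A \<inter> B = {}} = {({}, {})}" by auto
    then show ?thesis using True by simp
  next
    case False
    then have "{(A, B) \<in> \<A> \<times> \<B>. A \<inter> B = {}} = {}" using sub by auto
    then show ?thesis by (simp only: card.empty) simp
  qed
next
  case (insert x S)
  define D where "D \<A> \<B> = {(A, B) \<in> \<A> \<times> \<B>. A \<inter> B = {}}" for \<A> \<B> :: "'a set set"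
  define without with_x where "without \<F> = {X \<in> \<F>. x \<notin> X}"
    and "with_x \<F> = (\<lambda>X. X - {x}) ` {X \<in> \<F>. x \<in> X}" for \<F> :: "'a set set"
  have sub: "without \<F> \<subseteq> Pow S" "with_x \<F> \<subseteq> Pow S" if "\<F> \<subseteq> Pow (insert x S)" for \<F>
    using that by (auto simp: without_def with_x_def)
  have fin_Pow: "finite \<F>" if "\<F> \<subseteq> Pow S" for \<F>
    using that insert.hyps by (meson finite_Pow_iff finite_subset)
  have fin_D: "finite (D \<F> \<G>)" if "\<F> \<subseteq> Pow S" "\<G> \<subseteq> Pow S" for \<F> \<G>
    by (rule finite_subset[of _ "\<F> \<times> \<G>"]) (auto simp: D_def fin_Pow that)
  have card_split: "card \<F> = card (without \<F>) + card (with_x \<F>)" if "\<F> \<subseteq> Pow (insert x S)" for \<F>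
  proof -
    have "finite \<F>" using that insert.hyps by (meson finite_Pow_iff finite_insert finite_subset)
    moreover have "\<F> = without \<F> \<union> {X \<in> \<F>. x \<in> X}" by (auto simp: without_def)
    moreover have "without \<F> \<inter> {X \<in> \<F>. x \<in> X} = {}" by (auto simp: without_def)
    ultimately have "card \<F> = card (without \<F>) + card {X \<in> \<F>. x \<in> X}"
      by (metis card_Un_disjoint finite_Un)
    moreover have "inj_on (\<lambda>X. X - {x}) {X \<in> \<F>. x \<in> X}" by (auto simp: inj_on_def)
    ultimately show ?thesis by (simp add: with_x_def card_image)
  qed
  let ?A0 = "without \<A>" and ?A1 = "with_x \<A>" and ?B0 = "without \<B>" and ?B1 = "with_x \<B>"
  note subs = sub[OF insert.prems(1)] sub[OF insert.prems(2)]
  \<comment> \<open>An inclusion suffices: putting \<open>x\<close> back into one coordinate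
    recovers every disjoint pair, and images do not increase cardinality.\<close>
  have "D \<A> \<B> \<subseteq> D ?A0 ?B0 \<union> map_prod id (insert x) ` D ?A0 ?B1 \<union> map_prod (insert x) id ` D ?A1 ?B0"
  proof
    fix z assume "z \<in> D \<A> \<B>"
    then obtain X Y where z: "z = (X, Y)" "X \<in> \<A>" "Y \<in> \<B>" "X \<inter> Y = {}"
      by (auto simp: D_def)
    consider "x \<notin> X" "x \<notin> Y" | "x \<notin> X" "x \<in> Y" | "x \<in> X" "x \<notin> Y" using z by blast
    then show "z \<in> D ?A0 ?B0 \<union> map_prod id (insert x) ` D ?A0 ?B1 \<union> map_prod (insert x) id ` D ?A1 ?B0"
    proof cases
      case 1
      then show ?thesis using z by (auto simp: D_def without_def)
    next
      case 2
      then have "(X, Y - {x}) \<in> D ?A0 ?B1" using z by (auto simp: D_def without_def with_x_def)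
      then have "map_prod id (insert x) (X, Y - {x}) \<in> map_prod id (insert x) ` D ?A0 ?B1"
        by (rule imageI)
      then show ?thesis using 2 z by (simp add: insert_absorb)
    next
      case 3
      then have "(X - {x}, Y) \<in> D ?A1 ?B0" using z by (auto simp: D_def without_def with_x_def)
      then have "map_prod (insert x) id (X - {x}, Y) \<in> map_prod (insert x) id ` D ?A1 ?B0"
        by (rule imageI)
      then show ?thesis using 3 z by (simp add: insert_absorb)
    qed
  qed
  then have "card (D \<A> \<B>) \<le> card (D ?A0 ?B0 \<union> map_prod id (insert x) ` D ?A0 ?B1
      \<union> map_prod (insert x) id ` D ?A1 ?B0)"
    by (intro card_mono) (auto simp: fin_D subs)
  also have "\<dots> \<le> card (D ?A0 ?B0) + card (map_prod id (insert x) ` D ?A0 ?B1)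
      + card (map_prod (insert x) id ` D ?A1 ?B0)"
    by (intro order_trans[OF card_Un_le] add_right_mono card_Un_le)
  also have "\<dots> \<le> card (D ?A0 ?B0) + card (D ?A0 ?B1) + card (D ?A1 ?B0)"
    by (intro add_mono card_image_le order_refl fin_D subs)
  finally have "real (card (D \<A> \<B>))
      \<le> real (card (D ?A0 ?B0)) + real (card (D ?A0 ?B1)) + real (card (D ?A1 ?B0))"
    by linarith
  also have "\<dots> \<le> C ^ card S * (real (card ?A0) powr s * real (card ?B0) powr s)
      + C ^ card S * (real (card ?A0) powr s * real (card ?B1) powr s)
      + C ^ card S * (real (card ?A1) powr s * real (card ?B0) powr s)"
    unfolding D_def by (intro add_mono insert.IH subs)
  also have "\<dots> = C ^ card S * (real (card ?A0) powr s * real (card ?B0) powr s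
      + real (card ?A0) powr s * real (card ?B1) powr s
      + real (card ?A1) powr s * real (card ?B0) powr s)"
    by (simp add: algebra_simps)
  also have "\<dots> \<le> C ^ card S * (C * ((real (card ?A0) + real (card ?A1)) powr s
      * (real (card ?B0) + real (card ?B1)) powr s))"
    using C by (intro mult_left_mono two_point) auto
  also have "\<dots> = C ^ card (insert x S) * (real (card \<A>) powr s * real (card \<B>) powr s)"
    using insert.hyps card_split[OF insert.prems(1)] card_split[OF insert.prems(2)] by simp
  finally show ?case by (simp add: D_def)
qed

section \<open>The density bound\<close>

theorem theorem3p2:
  fixes n m :: nat and \<delta> :: real and \<A> \<B> :: "nat set set"
  assumes "n > 0"
    and "10 ^ 4 * (log 2 (real n) / real n) \<le> \<delta>" and "\<delta> \<le> 1 / 2"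
    and "\<A> \<subseteq> Pow {1..n}" and "\<B> \<subseteq> Pow {1..n}"
    and "card \<A> = m" and "card \<B> = m"
    and "real m = 2 powr ((1 / 2 + \<delta>) * real n)"
  shows "disjointness_density \<A> \<B> \<le> 2 powr (- (\<delta> / (100 * log 2 (1 / \<delta>))) * real n)"
proof (cases "\<delta> = 0")
  \<comment> \<open>This happens only for \<open>n = 1\<close>. The exponent is then 0, so the claim
    is that the density is at most 1.\<close>
  case True
  have "finite \<A>" "finite \<B>" using assms(4,5) by (auto intro: finite_subset)
  then have "card {(A, B) \<in> \<A> \<times> \<B>. A \<inter> B = {}} \<le> card (\<A> \<times> \<B>)"
    by (intro card_mono) auto
  then have "real (card {(A, B) \<in> \<A> \<times> \<B>. A \<inter> B = {}}) \<le> real m * real m"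
    using assms(6,7) by (simp add: card_cartesian_product flip: of_nat_mult)
  then show ?thesis using True assms(6-8) by (simp add: disjointness_density_def divide_le_eq)
next
  case False
  have "0 \<le> log 2 (real n)" using \<open>n > 0\<close> by simp
  then have "0 \<le> 10 ^ 4 * (log 2 (real n) / real n)" by simp
  then have d: "0 < \<delta>" using assms(2) False by linarith
  define q where "q = 100 * log 2 (1 / \<delta>)"
  have "log 2 2 \<le> log 2 (1 / \<delta>)" using d assms(3) by (subst log_le_cancel_iff) (auto simp: field_simps)
  then have q: "1 < q" by (simp add: q_def)
  define C where "C = (2 + \<delta>) powr (1/q)"
  have "real (card {(A, B) \<in> \<A> \<times> \<B>. A \<inter> B = {}})
      \<le> C ^ card {1..n} * (real (card \<A>) powr (1 - 1/q) * real (card \<B>) powr (1 - 1/q))"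
    unfolding C_def
    by (intro card_disjoint_pairs_le two_point_inequality powr_sum_bound)
      (use assms d q q_def in auto)
  also have "\<dots> = C ^ n * real m powr (2 - 2/q)"
    using assms(6,7) by (simp flip: powr_add)
  finally have "disjointness_density \<A> \<B> \<le> C ^ n * real m powr (2 - 2/q) / (real m * real m)"
    using assms(6,7) by (simp add: disjointness_density_def divide_right_mono)
  also have "\<dots> = C ^ n * real m powr (- 2/q)"
  proof -
    have "real m powr (2 - 2/q) = real m powr 2 * real m powr (- 2/q)"
      unfolding powr_add[symmetric] by simp
    moreover have "real m > 0" using assms(8) by simp
    ultimately show ?thesis by (simp add: powr_numeral power2_eq_square)
  qed
  also have "\<dots> \<le> (2 powr ((1 + \<delta>) / q)) ^ n * real m powr (- 2/q)"
  proof -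
    have "1 + \<delta> / 2 \<le> 1 + \<delta> * ln 2" using ln2_ge_two_thirds d by (intro add_left_mono) auto
    also have "\<dots> \<le> 2 powr \<delta>" using exp_ge_add_one_self[of "\<delta> * ln 2"] by (simp add: powr_def)
    finally have "2 + \<delta> \<le> 2 powr (1 + \<delta>)" by (simp add: powr_add)
    then have "C \<le> (2 powr (1 + \<delta>)) powr (1/q)"
      unfolding C_def using d q by (intro powr_mono2) auto
    then have "C \<le> 2 powr ((1 + \<delta>) / q)" by (simp add: powr_powr)
    then show ?thesis by (intro mult_right_mono power_mono) (auto simp: C_def)
  qed
  \<comment> \<open>The exponents combine to ((1 + \<delta>) - (1 + 2 \<delta>)) n/q: the 1 from the
    base 2 + \<delta> cancels the two halves from the family sizes.\<close>
  also have "\<dots> = 2 powr ((1 + \<delta>) / q * n + (1 / 2 + \<delta>) * n * (- 2/q))"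
    unfolding assms(8) powr_add by (simp add: powr_powr flip: powr_realpow)
  also have "(1 + \<delta>) / q * n + (1 / 2 + \<delta>) * n * (- 2/q) = - (\<delta> / q) * n"
    using q by (simp add: field_simps)
  finally show ?thesis by (simp add: q_def)
qed

end
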